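(* Let $B=(b_{i,j})\in M_2(\mathbb{R})$ have nonnegative entries and let $A=(a_{i,j})$ be its entrywise square root, $a_{1,1}=\alpha$, $a_{1,2}=\beta$, $a_{2,1}=\gamma$, $a_{2,2}=\delta$. For $i,j\in\{1,2\}$ let $\mu_{i,j}$ be the probability measure on $\mathbb{R}$ with K-transform $K_{i,j}$ associated with $B$, and let $\mu_0=\mu_{1,1}\uplus\mu_{2,2}$, $\mu_1=\mu_{1,1}\uplus\mu_{2,1}$, $\mu_2=\mu_{1,2}\uplus\mu_{2,2}$. Let $\xi_0,\xi_1,\xi_2$ be the multiplicative matricial weight functions on the set of walks on the rooted binary tree $\mathbb{T}_2$ associated with the matrix $A$ and the initial weights $\{\alpha,\delta\}$, $\{\alpha,\gamma\}$ and $\{\beta,\delta\}$, respectively. Then $$M_{\mu_j}(n)=\sum_{w\in W(n)}\xi_j(w)$$ for $j=0,1,2$ and any $n\in\mathbb{N}$, where $M_{\mu_j}(n)$ is the $n$-th moment of $\mu_j$ and $W(n)$ denotes the set of root-to-root walks on $\mathbb{T}_2$ of length $n$.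
   Context: For a probability measure $\mu$ on $\mathbb{R}$ with Cauchy transform $G_\mu$, let $F_\mu=1/G_\mu$ and $K_\mu(z)=z-F_\mu(z)$ (the K-transform), $z\in\mathbb{C}^+$. The boolean convolution $\mu\uplus\nu$ is the probability measure with $K_{\mu\uplus\nu}=K_\mu+K_\nu$. For $B=(b_{i,j})\in M_r(\mathbb{R})$ with nonnegative entries, put $K^{(0)}_{i,j}(z)=b_{i,j}/z$ and $K^{(m)}_{i,j}(z)=b_{i,j}/(z-\sum_{p=1}^r K^{(m-1)}_{p,i}(z))$ for $m\ge1$; $K_{i,j}=\lim_m K^{(m)}_{i,j}$ (locally uniformly on $\mathbb{C}^+$) is the K-transform of a compactly supported probability measure $\mu_{i,j}$. $\mathbb{T}_2$ is the infinite rooted binary tree (every vertex has exactly two children) with root $e$. Walks are described as sequences of edges $w=(E_1,\dots,E_n)$ (edges may be traversed in both directions), and a weight function $\xi$ on edges is extended multiplicatively to walks by $\xi(w)=\xi(E_1)\cdots\xi(E_n)$. The matricial weight function associated with $A$ and initial weights $\{a_{i,j},a_{k,l}\}$ is defined by labelling edges with index pairs: the two edges at the root are labelled $(i,j)$ and $(k,l)$; if an edge is labelled $(p,q)$, then the two edges immediately below it (its children) are labelled $(1,p)$ and $(2,p)$; an edge labelled $(p,q)$ has weight $a_{p,q}$. *)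

theory Defs
  imports "HOL-Probability.Probability"
begin

definition Cauchy_transform :: "real measure \<Rightarrow> complex \<Rightarrow> complex" where
  "Cauchy_transform \<mu> z = (LINT x|\<mu>. 1 / (z - complex_of_real x))"

definition F_transform :: "real measure \<Rightarrow> complex \<Rightarrow> complex" where
  "F_transform \<mu> z = 1 / Cauchy_transform \<mu> z"

definition K_transform :: "real measure \<Rightarrow> complex \<Rightarrow> complex" where
  "K_transform \<mu> z = z - F_transform \<mu> z"

text \<open>
  A probability measure on the real line is determined by its K-transform on the upper
  half-plane, so the next two relations each describe at most one measure.
\<close>

definition has_K_transform :: "real measure \<Rightarrow> (complex \<Rightarrow> complex) \<Rightarrow> bool" where
  "has_K_transform \<mu> K \<longleftrightarrow> real_distribution \<mu> \<and> (\<forall>z. Im z > 0 \<longrightarrow> K_transform \<mu> z = K z)"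

text \<open>\<open>is_boolean_convolution \<mu> \<nu> \<rho>\<close> says that \<open>\<rho>\<close> is the boolean convolution of \<open>\<mu>\<close> and \<open>\<nu>\<close>.\<close>

definition is_boolean_convolution :: "real measure \<Rightarrow> real measure \<Rightarrow> real measure \<Rightarrow> bool" where
  "is_boolean_convolution \<mu> \<nu> \<rho> \<longleftrightarrow>
     has_K_transform \<rho> (\<lambda>z. K_transform \<mu> z + K_transform \<nu> z)"

primrec K_approx :: "real ^ 'r ^ 'r \<Rightarrow> nat \<Rightarrow> 'r::finite \<Rightarrow> 'r \<Rightarrow> complex \<Rightarrow> complex" where
  "K_approx B 0 = (\<lambda>i j z. complex_of_real (B $ i $ j) / z)"
| "K_approx B (Suc m) =
     (\<lambda>i j z. complex_of_real (B $ i $ j) / (z - (\<Sum>p\<in>UNIV. K_approx B m p i z)))"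

text \<open>
  The limit is taken pointwise; for entrywise nonnegative \<open>B\<close> it exists (even locally
  uniformly) on the upper half-plane.
\<close>

definition K_limit :: "real ^ 'r ^ 'r \<Rightarrow> 'r::finite \<Rightarrow> 'r \<Rightarrow> complex \<Rightarrow> complex" where
  "K_limit B i j z = lim (\<lambda>m. K_approx B m i j z)"

text \<open>
  The two-element index type \<open>2\<close> has the elements \<open>1\<close> and \<open>2\<close>. Vertices of the rooted binary
  tree are lists over it: the root is \<open>[]\<close>, and \<open>1 # v\<close> and \<open>2 # v\<close> are the children of \<open>v\<close>.
  Edges are unordered pairs, since they may be traversed in both directions.
\<close>

type_synonym vertex = "2 list"
type_synonym edge = "vertex set"

definition tree_edges :: "edge set" where
  "tree_edges = {{v, c # v} | v c. True}"

primrec is_walk :: "vertex \<Rightarrow> edge list \<Rightarrow> vertex \<Rightarrow> bool" where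
  "is_walk u [] v \<longleftrightarrow> u = v"
| "is_walk u (E # w) v \<longleftrightarrow> E \<in> tree_edges \<and> (\<exists>x. E = {u, x} \<and> is_walk x w v)"

definition root_walks :: "nat \<Rightarrow> edge list set" where
  "root_walks n = {w. length w = n \<and> is_walk [] w []}"

definition lower_vertex :: "edge \<Rightarrow> vertex" where
  "lower_vertex E = (THE x. \<exists>v c. x = c # v \<and> E = {v, x})"

lemma lower_vertex_edge: "lower_vertex {v, c # v} = c # v"
  unfolding lower_vertex_def
  by (rule the_equality) (auto simp: doubleton_eq_iff)

text \<open>
  The label of the edge joining a non-root vertex to its parent, where \<open>s\<close> and \<open>t\<close> label the two
  root edges: below an edge labelled \<open>(p, q)\<close> lie edges labelled \<open>(1, p)\<close> and \<open>(2, p)\<close>.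
  The value at the root is irrelevant.
\<close>

fun vertex_label :: "2 \<times> 2 \<Rightarrow> 2 \<times> 2 \<Rightarrow> vertex \<Rightarrow> 2 \<times> 2" where
  "vertex_label s t [] = undefined"
| "vertex_label s t [c] = (if c = 1 then s else t)"
| "vertex_label s t (c # d # v) = (c, fst (vertex_label s t (d # v)))"

definition edge_label :: "2 \<times> 2 \<Rightarrow> 2 \<times> 2 \<Rightarrow> edge \<Rightarrow> 2 \<times> 2" where
  "edge_label s t E = vertex_label s t (lower_vertex E)"

definition edge_weight :: "real ^ 2 ^ 2 \<Rightarrow> 2 \<times> 2 \<Rightarrow> 2 \<times> 2 \<Rightarrow> edge \<Rightarrow> real" where
  "edge_weight A s t E = (case edge_label s t E of (p, q) \<Rightarrow> A $ p $ q)"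

definition walk_weight :: "real ^ 2 ^ 2 \<Rightarrow> 2 \<times> 2 \<Rightarrow> 2 \<times> 2 \<Rightarrow> edge list \<Rightarrow> real" where
  "walk_weight A s t w = prod_list (map (edge_weight A s t) w)"

text \<open>
  The Bochner integral of a non-integrable function is \<open>0\<close> by convention, hence the explicit
  integrability condition.
\<close>

definition has_moment :: "real measure \<Rightarrow> nat \<Rightarrow> real \<Rightarrow> bool" where
  "has_moment \<mu> n m \<longleftrightarrow> integrable \<mu> (\<lambda>x. x ^ n) \<and> (LINT x|\<mu>. x ^ n) = m"

end

(*
  The resolvent of the weighted tree is explicit: its entry between the root and u is a product,
  over the edges from the root to u, of the continued fractions that define the K-transforms, and
  its root entry is the Cauchy transform of the boolean convolution.  Iterating the resolvent
  equation at z = i y gives the expansion of the Cauchy transform in powers of 1 / z, with the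
  weighted counts of root-to-root walks as coefficients and an error that is small as y tends to
  infinity.  As in the Hamburger-Nevanlinna theorem, such an expansion forces all moments to exist
  and to be the coefficients, so no Stieltjes inversion is needed.
*)

theory Submission
  imports Defs "HOL-Real_Asymp.Real_Asymp"
begin

section \<open>Moments from the asymptotics of the Cauchy transform\<close>

lemma Im_axis_resolvent:
  fixes x y :: real
  assumes "y > 0"
  shows "1 / (\<i> * complex_of_real y - complex_of_real x)
    = Complex (- (x / (x\<^sup>2 + y\<^sup>2))) (- (y / (x\<^sup>2 + y\<^sup>2)))"
  using assms by (simp add: complex_eq_iff Re_divide Im_divide power2_eq_square)

lemma sum_squares_pos: "y > 0 \<Longrightarrow> x\<^sup>2 + y\<^sup>2 > (0::real)"
  by (simp add: add_nonneg_pos)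

lemma integrable_Im_axis_resolvent:
  assumes "real_distribution M" "y > 0"
  shows "integrable M (\<lambda>x. 1 / (\<i> * complex_of_real y - complex_of_real x))"
proof -
  interpret real_distribution M by fact
  have "norm (1 / (\<i> * complex_of_real y - complex_of_real x)) \<le> 1 / y" for x
  proof -
    have "y \<le> norm (\<i> * complex_of_real y - complex_of_real x)"
      using abs_Im_le_cmod[of "\<i> * complex_of_real y - complex_of_real x"] assms(2) by simp
    then show ?thesis using assms(2) by (simp add: norm_divide divide_left_mono frac_le)
  qed
  then show ?thesis
    by (intro integrable_const_bound[where B = "1 / y"]) auto
qed

lemma Cauchy_transform_Im_axis:
  assumes "real_distribution M" "y > 0"
  shows "integrable M (\<lambda>x. x / (x\<^sup>2 + y\<^sup>2))"
    and "integrable M (\<lambda>x. y / (x\<^sup>2 + y\<^sup>2))"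
    and "Re (Cauchy_transform M (\<i> * of_real y)) = - (LINT x|M. x / (x\<^sup>2 + y\<^sup>2))"
    and "Im (Cauchy_transform M (\<i> * of_real y)) = - (LINT x|M. y / (x\<^sup>2 + y\<^sup>2))"
proof -
  note int = integrable_Im_axis_resolvent[OF assms]
  have "integrable M (\<lambda>x. - Re (1 / (\<i> * complex_of_real y - complex_of_real x)))"
    "integrable M (\<lambda>x. - Im (1 / (\<i> * complex_of_real y - complex_of_real x)))"
    using integrable_Re[OF int] integrable_Im[OF int] by simp_all
  then show "integrable M (\<lambda>x. x / (x\<^sup>2 + y\<^sup>2))" "integrable M (\<lambda>x. y / (x\<^sup>2 + y\<^sup>2))"
    unfolding Im_axis_resolvent[OF assms(2)] by simp_all
  show "Re (Cauchy_transform M (\<i> * of_real y)) = - (LINT x|M. x / (x\<^sup>2 + y\<^sup>2))"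
    "Im (Cauchy_transform M (\<i> * of_real y)) = - (LINT x|M. y / (x\<^sup>2 + y\<^sup>2))"
    unfolding Cauchy_transform_def using integral_Re[OF int] integral_Im[OF int]
    unfolding Im_axis_resolvent[OF assms(2)] by simp_all
qed

text \<open>The remainder of the formal expansion of the Cauchy transform into terms s k / z^(k+1),
  scaled by z^(n+1): its expected limit is s n, not 0.\<close>

definition Cauchy_remainder :: "real measure \<Rightarrow> (nat \<Rightarrow> real) \<Rightarrow> nat \<Rightarrow> complex \<Rightarrow> complex" where
  "Cauchy_remainder M s n z =
     z ^ Suc n * Cauchy_transform M z - (\<Sum>k<n. of_real (s k) * z ^ (n - k))"

lemma Cauchy_remainder_Suc:
  "Cauchy_remainder M s (Suc n) z = z * (Cauchy_remainder M s n z - of_real (s n))"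
proof -
  have "(\<Sum>k<n. of_real (s k) * z ^ (Suc n - k)) = z * (\<Sum>k<n. of_real (s k) * z ^ (n - k))"
    unfolding sum_distrib_left by (intro sum.cong) (auto simp: Suc_diff_le)
  then show ?thesis
    unfolding Cauchy_remainder_def by (simp add: algebra_simps)
qed

text \<open>Two steps multiply by z^2 = - y^2, which is real, so real parts satisfy a recursion of
  their own; the coefficient of index n + 1 enters only the imaginary part.\<close>

lemma Re_Cauchy_remainder_Suc_Suc:
  "Re (Cauchy_remainder M s (Suc (Suc n)) (\<i> * of_real y))
    = - y\<^sup>2 * (Re (Cauchy_remainder M s n (\<i> * of_real y)) - s n)"
  unfolding Cauchy_remainder_Suc by (simp add: algebra_simps power2_eq_square)

text \<open>The damping factor lies in (0, 1] and tends to 1 as y grows, so these integrals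
  approximate the n-th moment before that moment is known to exist.\<close>

definition damped_moment_rep :: "real measure \<Rightarrow> (nat \<Rightarrow> real) \<Rightarrow> nat \<Rightarrow> bool" where
  "damped_moment_rep M s n \<longleftrightarrow> (\<forall>y>0.
     has_bochner_integral M (\<lambda>x. x ^ n * (y\<^sup>2 / (x\<^sup>2 + y\<^sup>2)))
       (Re (Cauchy_remainder M s n (\<i> * of_real y))))"

text \<open>The two base cases split the Cauchy transform on the imaginary axis: its imaginary part
  gives order 0, its real part order 1.\<close>

lemma damped_moment_rep_0:
  assumes "real_distribution M"
  shows "damped_moment_rep M s 0"
  unfolding damped_moment_rep_def
proof (intro allI impI)
  fix y :: real assume y: "y > 0"
  have "has_bochner_integral M (\<lambda>x. y * (y / (x\<^sup>2 + y\<^sup>2))) (y * (LINT x|M. y / (x\<^sup>2 + y\<^sup>2)))"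
    by (intro has_bochner_integral_mult_right has_bochner_integral_integrable
        Cauchy_transform_Im_axis(2)[OF assms y])
  then show "has_bochner_integral M (\<lambda>x. x ^ 0 * (y\<^sup>2 / (x\<^sup>2 + y\<^sup>2)))
      (Re (Cauchy_remainder M s 0 (\<i> * of_real y)))"
    by (simp add: Cauchy_remainder_def Cauchy_transform_Im_axis(4)[OF assms y] power2_eq_square)
qed

lemma damped_moment_rep_1:
  assumes "real_distribution M"
  shows "damped_moment_rep M s 1"
  unfolding damped_moment_rep_def
proof (intro allI impI)
  fix y :: real assume y: "y > 0"
  have "has_bochner_integral M (\<lambda>x. y\<^sup>2 * (x / (x\<^sup>2 + y\<^sup>2))) (y\<^sup>2 * (LINT x|M. x / (x\<^sup>2 + y\<^sup>2)))"
    by (intro has_bochner_integral_mult_right has_bochner_integral_integrable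
        Cauchy_transform_Im_axis(1)[OF assms y])
  then show "has_bochner_integral M (\<lambda>x. x ^ 1 * (y\<^sup>2 / (x\<^sup>2 + y\<^sup>2)))
      (Re (Cauchy_remainder M s 1 (\<i> * of_real y)))"
    by (simp add: Cauchy_remainder_def Cauchy_transform_Im_axis(3)[OF assms y] power2_eq_square
        mult_ac)
qed

text \<open>One minus the damping factor is x^2 / (x^2 + y^2), so the damped moment of order n + 2
  is y^2 times the gap between the full and the damped moment of order n. Splitting off the full
  moment requires that it exists, hence moments and representations are established
  alternately.\<close>

lemma damped_moment_rep_Suc_Suc:
  assumes rep: "damped_moment_rep M s n" and mom: "has_moment M n (s n)"
  shows "damped_moment_rep M s (Suc (Suc n))"
  unfolding damped_moment_rep_def
proof (intro allI impI)
  fix y :: real assume y: "y > 0"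
  have "has_bochner_integral M (\<lambda>x. x ^ n) (s n)"
    using mom unfolding has_moment_def has_bochner_integral_iff by simp
  moreover have "has_bochner_integral M (\<lambda>x. x ^ n * (y\<^sup>2 / (x\<^sup>2 + y\<^sup>2)))
      (Re (Cauchy_remainder M s n (\<i> * of_real y)))"
    using rep y unfolding damped_moment_rep_def by blast
  ultimately have "has_bochner_integral M
      (\<lambda>x. - y\<^sup>2 * (x ^ n * (y\<^sup>2 / (x\<^sup>2 + y\<^sup>2)) - x ^ n))
      (- y\<^sup>2 * (Re (Cauchy_remainder M s n (\<i> * of_real y)) - s n))"
    by (intro has_bochner_integral_mult_right has_bochner_integral_diff)
  moreover have "- y\<^sup>2 * (x ^ n * (y\<^sup>2 / (x\<^sup>2 + y\<^sup>2)) - x ^ n) = x ^ Suc (Suc n) * (y\<^sup>2 / (x\<^sup>2 + y\<^sup>2))"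
    for x
  proof -
    have "x\<^sup>2 / (x\<^sup>2 + y\<^sup>2) + y\<^sup>2 / (x\<^sup>2 + y\<^sup>2) = 1"
      unfolding add_divide_distrib[symmetric] using sum_squares_pos[OF y, of x] y by simp
    then have "y\<^sup>2 / (x\<^sup>2 + y\<^sup>2) - 1 = - (x\<^sup>2 / (x\<^sup>2 + y\<^sup>2))"
      by linarith
    then have "x ^ n * (y\<^sup>2 / (x\<^sup>2 + y\<^sup>2) - 1) * - y\<^sup>2 = x ^ n * - (x\<^sup>2 / (x\<^sup>2 + y\<^sup>2)) * - y\<^sup>2"
      by simp
    then show ?thesis by (simp add: algebra_simps power2_eq_square)
  qed
  ultimately show "has_bochner_integral M (\<lambda>x. x ^ Suc (Suc n) * (y\<^sup>2 / (x\<^sup>2 + y\<^sup>2)))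
      (Re (Cauchy_remainder M s (Suc (Suc n)) (\<i> * of_real y)))"
    unfolding Re_Cauchy_remainder_Suc_Suc by simp
qed

text \<open>The convergence theorems for integrals run along sequences; y = m + 1 keeps y
  positive.\<close>

lemma damping_factor_tendsto:
  "(\<lambda>m. (real (Suc m))\<^sup>2 / (x\<^sup>2 + (real (Suc m))\<^sup>2)) \<longlonglongrightarrow> 1"
proof -
  have "(\<lambda>m. 1 / (x\<^sup>2 * (inverse (real (Suc m)))\<^sup>2 + 1)) \<longlonglongrightarrow> 1 / (x\<^sup>2 * 0\<^sup>2 + 1)"
    by (intro tendsto_intros LIMSEQ_inverse_real_of_nat) auto
  moreover have "1 / (x\<^sup>2 * (inverse (real (Suc m)))\<^sup>2 + 1)
      = (real (Suc m))\<^sup>2 / (x\<^sup>2 + (real (Suc m))\<^sup>2)" for m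
    using sum_squares_pos[of "real (Suc m)" x] by (simp add: field_simps)
  ultimately show ?thesis by simp
qed

lemma damping_factor_mono:
  fixes a b x :: real
  assumes "0 < a" "a \<le> b"
  shows "a\<^sup>2 / (x\<^sup>2 + a\<^sup>2) \<le> b\<^sup>2 / (x\<^sup>2 + b\<^sup>2)"
proof -
  have "a\<^sup>2 * x\<^sup>2 \<le> b\<^sup>2 * x\<^sup>2"
    using assms by (intro mult_right_mono power_mono) auto
  then show ?thesis
    using sum_squares_pos[of a x] sum_squares_pos[of b x] assms
    by (simp add: frac_le_eq divide_le_0_iff algebra_simps)
qed

lemma damped_moment_tendsto:
  assumes rep: "damped_moment_rep M s n"
    and lim: "((\<lambda>y. Cauchy_remainder M s n (\<i> * of_real y)) \<longlongrightarrow> of_real (s n)) at_top"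
  shows "(\<lambda>m. LINT x|M. x ^ n * ((real (Suc m))\<^sup>2 / (x\<^sup>2 + (real (Suc m))\<^sup>2))) \<longlonglongrightarrow> s n"
proof -
  have "filterlim (\<lambda>m. real (Suc m)) at_top sequentially"
    using filterlim_real_sequentially filterlim_sequentially_Suc by blast
  then have "(\<lambda>m. Re (Cauchy_remainder M s n (\<i> * of_real (real (Suc m))))) \<longlonglongrightarrow> Re (of_real (s n))"
    by (intro tendsto_Re filterlim_compose[OF lim])
  moreover have "(LINT x|M. x ^ n * ((real (Suc m))\<^sup>2 / (x\<^sup>2 + (real (Suc m))\<^sup>2)))
      = Re (Cauchy_remainder M s n (\<i> * of_real (real (Suc m))))" for m
  proof -
    have "0 < real (Suc m)" by simp
    then show ?thesis
      using rep unfolding damped_moment_rep_def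
      by (intro has_bochner_integral_integral_eq) blast
  qed
  ultimately show ?thesis by simp
qed

text \<open>The damping factor is at most 1, so the undamped power dominates, and uniqueness of the
  limit identifies its integral.\<close>

lemma has_moment_if_integrable:
  assumes "real_distribution M" and rep: "damped_moment_rep M s n"
    and lim: "((\<lambda>y. Cauchy_remainder M s n (\<i> * of_real y)) \<longlongrightarrow> of_real (s n)) at_top"
    and int: "integrable M (\<lambda>x. x ^ n)"
  shows "has_moment M n (s n)"
proof -
  interpret real_distribution M by fact
  have "(\<lambda>m. LINT x|M. x ^ n * ((real (Suc m))\<^sup>2 / (x\<^sup>2 + (real (Suc m))\<^sup>2)))
      \<longlonglongrightarrow> (LINT x|M. x ^ n)"
  proof (rule integral_dominated_convergence[where w = "\<lambda>x. \<bar>x ^ n\<bar>"])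
    show "AE x in M. (\<lambda>m. x ^ n * ((real (Suc m))\<^sup>2 / (x\<^sup>2 + (real (Suc m))\<^sup>2))) \<longlonglongrightarrow> x ^ n"
      using tendsto_mult[OF tendsto_const damping_factor_tendsto] by fastforce
    show "AE x in M. norm (x ^ n * ((real (Suc m))\<^sup>2 / (x\<^sup>2 + (real (Suc m))\<^sup>2))) \<le> \<bar>x ^ n\<bar>" for m
    proof (rule AE_I2)
      fix x
      have "(real (Suc m))\<^sup>2 / (x\<^sup>2 + (real (Suc m))\<^sup>2) \<le> 1"
        using sum_squares_pos[of "real (Suc m)" x] by (simp add: divide_le_eq)
      then show "norm (x ^ n * ((real (Suc m))\<^sup>2 / (x\<^sup>2 + (real (Suc m))\<^sup>2))) \<le> \<bar>x ^ n\<bar>"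
        using mult_left_le[OF _ abs_ge_zero, of _ "x ^ n"]
        by (simp add: abs_mult del: of_nat_Suc times_divide_eq_right)
    qed
  qed (use int in auto)
  then show ?thesis
    using LIMSEQ_unique[OF _ damped_moment_tendsto[OF rep lim]] int unfolding has_moment_def by blast
qed

text \<open>For even n the damped integrands are nonnegative and increase with y, so monotone
  convergence yields integrability together with the value.\<close>

lemma has_moment_if_even:
  assumes "real_distribution M" and rep: "damped_moment_rep M s n" and "even n"
    and lim: "((\<lambda>y. Cauchy_remainder M s n (\<i> * of_real y)) \<longlongrightarrow> of_real (s n)) at_top"
  shows "has_moment M n (s n)"
proof -
  interpret real_distribution M by fact
  let ?f = "\<lambda>m x. x ^ n * ((real (Suc m))\<^sup>2 / (x\<^sup>2 + (real (Suc m))\<^sup>2))"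
  have "integrable M (?f m)" for m
    using rep unfolding damped_moment_rep_def has_bochner_integral_iff by (simp del: of_nat_Suc)
  moreover have "AE x in M. mono (\<lambda>m. ?f m x)"
  proof (intro AE_I2 monoI mult_left_mono)
    fix x :: real and i j :: nat assume "i \<le> j"
    then show "(real (Suc i))\<^sup>2 / (x\<^sup>2 + (real (Suc i))\<^sup>2) \<le> (real (Suc j))\<^sup>2 / (x\<^sup>2 + (real (Suc j))\<^sup>2)"
      by (intro damping_factor_mono) auto
    show "0 \<le> x ^ n" using \<open>even n\<close> by (rule zero_le_even_power)
  qed
  moreover have "AE x in M. (\<lambda>m. ?f m x) \<longlonglongrightarrow> x ^ n"
    using tendsto_mult[OF tendsto_const damping_factor_tendsto] by fastforce
  ultimately have "has_bochner_integral M (\<lambda>x. x ^ n) (s n)"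
    by (rule has_bochner_integral_monotone_convergence[OF _ _ _ damped_moment_tendsto[OF rep lim]])
      measurable
  then show ?thesis by (simp add: has_moment_def has_bochner_integral_iff)
qed

text \<open>Even moments come first, by monotone convergence; they make the preceding odd power
  integrable, so that dominated convergence applies to it.\<close>

theorem has_moment_of_Cauchy_asymptotics:
  assumes M: "real_distribution M"
    and lim: "\<And>n. ((\<lambda>y. Cauchy_remainder M s n (\<i> * of_real y)) \<longlongrightarrow> of_real (s n)) at_top"
  shows "has_moment M n (s n)"
proof -
  interpret real_distribution M by fact
  note even_moment = has_moment_if_even[OF M _ _ lim]
  have step: "has_moment M (Suc k) (s (Suc k))"
    if "has_moment M (Suc (Suc k)) c" "damped_moment_rep M s (Suc k)" for k c
  proof (rule has_moment_if_integrable[OF M that(2) lim])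
    show "integrable M (\<lambda>x. x ^ Suc k)"
    proof (rule Bochner_Integration.integrable_bound[where f = "\<lambda>x. 1 + \<bar>x ^ Suc (Suc k)\<bar>"])
      show "integrable M (\<lambda>x. 1 + \<bar>x ^ Suc (Suc k)\<bar>)"
        using that(1) unfolding has_moment_def
        by (intro Bochner_Integration.integrable_add integrable_abs) auto
      show "AE x in M. norm (x ^ Suc k) \<le> norm (1 + \<bar>x ^ Suc (Suc k)\<bar>)"
      proof (rule AE_I2)
        fix x :: real
        have "\<bar>x\<bar> ^ Suc k \<le> 1 + \<bar>x\<bar> ^ Suc (Suc k)"
        proof (cases "\<bar>x\<bar> \<le> 1")
          case True
          then show ?thesis
            using power_le_one[of "\<bar>x\<bar>" "Suc k"] by (smt (verit) abs_ge_zero zero_le_power)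
        next
          case False
          then have "\<bar>x\<bar> ^ Suc k \<le> \<bar>x\<bar> ^ Suc (Suc k)" by (intro power_increasing) auto
          then show ?thesis by simp
        qed
        then show "norm (x ^ Suc k) \<le> norm (1 + \<bar>x ^ Suc (Suc k)\<bar>)"
          by (simp add: power_abs abs_mult)
      qed
    qed auto
  qed
  \<comment> \<open>Order of the induction step: the moment 2m gives the representation at 2m + 2,
    hence the moment 2m + 2. This makes the moment 2m + 1 available, which in turn gives the
    representation at 2m + 3.\<close>
  have "has_moment M (2 * m) (s (2 * m)) \<and> damped_moment_rep M s (2 * m)
      \<and> damped_moment_rep M s (Suc (2 * m))" for m
  proof (induction m)
    case 0
    show ?case
      using damped_moment_rep_0[OF M, of s] damped_moment_rep_1[OF M, of s] even_moment[of 0]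
      by simp
  next
    case (Suc m)
    then have rep: "damped_moment_rep M s (Suc (Suc (2 * m)))"
      using damped_moment_rep_Suc_Suc by blast
    then have "has_moment M (Suc (Suc (2 * m))) (s (Suc (Suc (2 * m))))"
      by (intro even_moment) auto
    with rep show ?case
      using Suc step damped_moment_rep_Suc_Suc by auto
  qed
  then have "has_moment M (2 * m) (s (2 * m)) \<and> has_moment M (Suc (2 * m)) (s (Suc (2 * m)))" for m
    using step[of "2 * m"] by (metis mult_Suc_right add_2_eq_Suc)
  then show ?thesis
    by (cases "even n") (auto elim!: evenE oddE)
qed

section \<open>The continued fractions far from the origin\<close>

text \<open>The asymptotics concern only large z, and there convergence is elementary. Write N for
  the number of indices: subtracting N terms of norm at most 1 from z leaves a denominator of norm
  at least 1 + N M, which keeps the iterates bounded by 1 and makes the iteration contract.\<close>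

locale large_argument =
  fixes B :: "real ^ 'r ^ 'r::finite" and M :: real and z :: complex
  assumes B_nonneg: "\<And>i j. 0 \<le> B $ i $ j"
    and B_le: "\<And>i j. B $ i $ j \<le> M"
    and z_large: "1 + real CARD('r) + real CARD('r) * M \<le> norm z"
begin

lemma M_nonneg: "0 \<le> M"
  using B_nonneg B_le order_trans by blast

lemma M_le: "M \<le> real CARD('r) * M"
proof -
  have "1 * M \<le> real CARD('r) * M"
    using M_nonneg by (intro mult_right_mono) (simp_all add: Suc_le_eq)
  then show ?thesis by simp
qed

lemma norm_denominator_ge:
  assumes "\<And>p. norm (k p) \<le> (1::real)"
  shows "1 + real CARD('r) * M \<le> norm (z - (\<Sum>p\<in>UNIV. k (p :: 'r)))"
proof -
  have "norm (\<Sum>p\<in>UNIV. k p) \<le> real CARD('r) * 1"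
    using assms by (intro sum_norm_bound) auto
  then show ?thesis
    using norm_triangle_ineq2[of z "\<Sum>p\<in>UNIV. k p"] z_large by simp
qed

lemma norm_K_approx_le: "norm (K_approx B m i j z) \<le> 1"
proof (induction m arbitrary: i j)
  case 0
  have "B $ i $ j \<le> norm z"
    using z_large B_le[of i j] M_le by linarith
  then show ?case
    using B_nonneg[of i j] by (simp add: norm_divide divide_le_eq)
next
  case (Suc m)
  have "B $ i $ j \<le> norm (z - (\<Sum>p\<in>UNIV. K_approx B m p i z))"
    using norm_denominator_ge[of "\<lambda>p. K_approx B m p i z"] Suc.IH B_le[of i j] M_le by fastforce
  then show ?case
    using B_nonneg[of i j] by (simp add: norm_divide divide_le_eq)
qed

text \<open>Two fractions with the same numerator differ by that numerator times the difference of
  the denominators over their product. Summing over p costs a factor N and the numerator a factor M,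
  while the product is at least (1 + N M)^2, hence at least 2 N M: each step halves the error. The
  initial 2 bounds the difference of two iterates of norm at most 1.\<close>

lemma norm_K_approx_diff_le:
  "norm (K_approx B (Suc m) i j z - K_approx B m i j z) \<le> 2 * (1 / 2) ^ m"
proof (induction m arbitrary: i j)
  case 0
  show ?case
    using norm_triangle_ineq4[of "K_approx B (Suc 0) i j z" "K_approx B 0 i j z"]
      norm_K_approx_le[of "Suc 0" i j] norm_K_approx_le[of 0 i j] unfolding power_0 by linarith
next
  case (Suc m)
  let ?N = "real CARD('r)"
  let ?S = "\<lambda>m. \<Sum>p\<in>UNIV. K_approx B m p i z"
  have ge: "1 + ?N * M \<le> norm (z - ?S l)" for l
    by (intro norm_denominator_ge norm_K_approx_le)
  have NM: "0 \<le> ?N * M" using M_nonneg by simp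
  have nz: "z - ?S l \<noteq> 0" for l using ge[of l] NM by auto
  have "K_approx B (Suc (Suc m)) i j z - K_approx B (Suc m) i j z
      = of_real (B $ i $ j) / (z - ?S (Suc m)) - of_real (B $ i $ j) / (z - ?S m)"
    by (simp only: K_approx.simps(2))
  also have "\<dots> = of_real (B $ i $ j) * (?S (Suc m) - ?S m) / ((z - ?S (Suc m)) * (z - ?S m))"
    using nz[of m] nz[of "Suc m"]
    by (simp add: divide_simps del: K_approx.simps) (simp add: algebra_simps del: K_approx.simps)
  finally have eq: "K_approx B (Suc (Suc m)) i j z - K_approx B (Suc m) i j z = \<dots>" .
  have "norm (?S (Suc m) - ?S m) \<le> ?N * (2 * (1 / 2) ^ m)"
    unfolding sum_subtractf[symmetric] using Suc.IH by (intro sum_norm_bound) auto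
  then have "B $ i $ j * norm (?S (Suc m) - ?S m) \<le> M * (?N * (2 * (1 / 2) ^ m))"
    using B_nonneg B_le M_nonneg by (intro mult_mono) auto
  moreover have "2 * (?N * M) \<le> norm (z - ?S (Suc m)) * norm (z - ?S m)"
  proof -
    have "2 * (?N * M) \<le> (1 + ?N * M) * (1 + ?N * M)"
      using NM zero_le_square[of "?N * M"] unfolding distrib_left distrib_right by linarith
    also have "\<dots> \<le> norm (z - ?S (Suc m)) * norm (z - ?S m)"
      using ge NM by (intro mult_mono) (auto simp del: K_approx.simps)
    finally show ?thesis .
  qed
  then have "2 * (?N * M) * (1 / 2) ^ m \<le> norm (z - ?S (Suc m)) * norm (z - ?S m) * (1 / 2) ^ m"
    by (intro mult_right_mono) auto
  ultimately have "B $ i $ j * norm (?S (Suc m) - ?S m)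
      \<le> norm (z - ?S (Suc m)) * norm (z - ?S m) * (1 / 2) ^ m"
    by (simp only: mult_ac)
  then have "norm (K_approx B (Suc (Suc m)) i j z - K_approx B (Suc m) i j z) \<le> (1 / 2) ^ m"
    unfolding eq using nz B_nonneg
    by (simp add: norm_mult norm_divide divide_le_eq mult_ac del: K_approx.simps power_divide)
  then show ?case by simp
qed

lemma K_approx_tendsto: "(\<lambda>m. K_approx B m i j z) \<longlonglongrightarrow> K_limit B i j z"
proof -
  have "summable (\<lambda>m. K_approx B (Suc m) i j z - K_approx B m i j z)"
    by (rule summable_comparison_test'[where g = "\<lambda>m. 2 * (1 / 2) ^ m"])
      (use norm_K_approx_diff_le in \<open>auto intro!: summable_mult summable_geometric\<close>)
  then have "convergent (\<lambda>m. \<Sum>k<m. K_approx B (Suc k) i j z - K_approx B k i j z)"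
    unfolding summable_iff_convergent .
  then have "convergent (\<lambda>m. K_approx B m i j z - K_approx B 0 i j z)"
    unfolding sum_lessThan_telescope[of "\<lambda>m. K_approx B m i j z"] .
  then have "convergent (\<lambda>m. K_approx B m i j z)"
    using convergent_diff_const_right_iff by blast
  then show ?thesis
    unfolding K_limit_def convergent_LIMSEQ_iff .
qed

lemma norm_K_limit_le: "norm (K_limit B i j z) \<le> 1"
  by (rule Lim_norm_ubound[OF sequentially_bot K_approx_tendsto]) (simp add: norm_K_approx_le)

lemma K_limit_denominator_ge: "1 + real CARD('r) * M \<le> norm (z - (\<Sum>p\<in>UNIV. K_limit B p i z))"
  by (intro norm_denominator_ge norm_K_limit_le)

lemma K_limit_denominator_nonzero: "z - (\<Sum>p\<in>UNIV. K_limit B p i z) \<noteq> 0"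
proof -
  have "0 < 1 + real CARD('r) * M"
    using M_nonneg by (simp add: add_pos_nonneg)
  then show ?thesis
    using K_limit_denominator_ge[of i] by auto
qed

text \<open>Passing to the limit in the recursion gives the algebraic equation that, together with
  the norm bounds, drives the resolvent computation.\<close>

lemma K_limit_fixed_point:
  "K_limit B i j z = of_real (B $ i $ j) / (z - (\<Sum>p\<in>UNIV. K_limit B p i z))"
proof (rule LIMSEQ_unique)
  show "(\<lambda>m. K_approx B (Suc m) i j z) \<longlonglongrightarrow> K_limit B i j z"
    using K_approx_tendsto by (rule LIMSEQ_Suc)
  show "(\<lambda>m. K_approx B (Suc m) i j z)
      \<longlonglongrightarrow> of_real (B $ i $ j) / (z - (\<Sum>p\<in>UNIV. K_limit B p i z))"
    unfolding K_approx.simps(2)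
    by (intro tendsto_intros K_approx_tendsto K_limit_denominator_nonzero)
qed

end

section \<open>Weighted walks on the binary tree\<close>

text \<open>Arbitrary starting vertices are allowed so that removing the first edge of a walk gives
  a recursion.\<close>

definition walks_to_root :: "nat \<Rightarrow> vertex \<Rightarrow> edge list set" where
  "walks_to_root n u = {w. length w = n \<and> is_walk u w []}"

definition walk_sum :: "real ^ 2 ^ 2 \<Rightarrow> 2 \<times> 2 \<Rightarrow> 2 \<times> 2 \<Rightarrow> nat \<Rightarrow> vertex \<Rightarrow> real" where
  "walk_sum A s t n u = (\<Sum>w\<in>walks_to_root n u. walk_weight A s t w)"

definition neighbours :: "vertex \<Rightarrow> vertex set" where
  "neighbours u = {x. {u, x} \<in> tree_edges}"

lemma neighbours_Nil: "neighbours [] = {[1], [2]}"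
  unfolding neighbours_def tree_edges_def using exhaust_2
  by (auto simp: doubleton_eq_iff)

lemma neighbours_Cons: "neighbours (c # v) = {v, 1 # c # v, 2 # c # v}"
  unfolding neighbours_def tree_edges_def using exhaust_2
  by (auto simp: doubleton_eq_iff)

lemma finite_neighbours: "finite (neighbours u)"
  by (cases u) (simp_all add: neighbours_Nil neighbours_Cons)

lemma walks_to_root_0: "walks_to_root 0 u = (if u = [] then {[]} else {})"
  unfolding walks_to_root_def by auto

lemma walks_to_root_Suc:
  "walks_to_root (Suc n) u = (\<Union>x\<in>neighbours u. (#) {u, x} ` walks_to_root n x)"
  unfolding walks_to_root_def neighbours_def
  by (auto simp: length_Suc_conv image_iff)

lemma finite_walks_to_root: "finite (walks_to_root n u)"
  by (induction n arbitrary: u)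
    (simp_all add: walks_to_root_0 walks_to_root_Suc finite_neighbours)

lemma walk_sum_0: "walk_sum A s t 0 u = (if u = [] then 1 else 0)"
  by (simp add: walk_sum_def walks_to_root_0 walk_weight_def)

text \<open>Given u, the first edge determines the next vertex, so the walks split disjointly by
  that vertex. The recursion applies the weighted adjacency operator of the tree once.\<close>

lemma walk_sum_Suc:
  "walk_sum A s t (Suc n) u
    = (\<Sum>x\<in>neighbours u. edge_weight A s t {u, x} * walk_sum A s t n x)"
proof -
  have "walk_sum A s t (Suc n) u
      = (\<Sum>x\<in>neighbours u. \<Sum>w\<in>(#) {u, x} ` walks_to_root n x. walk_weight A s t w)"
    unfolding walk_sum_def walks_to_root_Suc
    by (intro sum.UNION_disjoint)
      (auto simp: finite_neighbours finite_walks_to_root doubleton_eq_iff)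
  also have "\<dots> = (\<Sum>x\<in>neighbours u. edge_weight A s t {u, x} * walk_sum A s t n x)"
    unfolding walk_sum_def sum_distrib_left
    by (rule sum.cong[OF refl]) (simp add: sum.reindex inj_on_def walk_weight_def)
  finally show ?thesis .
qed

lemma norm_sum_neighbours_le:
  fixes f :: "vertex \<Rightarrow> 'a :: real_normed_vector"
  assumes "\<And>x. norm (f x) \<le> c"
  shows "norm (\<Sum>x\<in>neighbours u. f x) \<le> 3 * c"
proof -
  have "0 \<le> c" using assms norm_ge_zero order_trans by blast
  have "card (neighbours u) \<le> 3"
    by (cases u) (simp_all add: neighbours_Nil neighbours_Cons card_insert_if)
  have "norm (\<Sum>x\<in>neighbours u. f x) \<le> real (card (neighbours u)) * c"
    using assms by (intro sum_norm_bound)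
  also have "\<dots> \<le> 3 * c"
    using \<open>0 \<le> c\<close> \<open>card (neighbours u) \<le> 3\<close> by (intro mult_right_mono) auto
  finally show ?thesis .
qed

text \<open>With T the weighted adjacency operator, the assumption on g reads (z - T) g = indicator
  of the root. Iterating it produces the walk sums as coefficients and a remainder that T maps to
  the next one; a vertex has at most three neighbours, so each iteration costs at most 3 D.\<close>

lemma resolvent_expansion:
  fixes g :: "vertex \<Rightarrow> complex"
  assumes z: "z \<noteq> 0"
    and g: "\<And>u. z * g u = (if u = [] then 1 else 0)
      + (\<Sum>x\<in>neighbours u. of_real (edge_weight A s t {u, x}) * g x)"
    and bound: "\<And>u. norm (g u) \<le> C"
    and weight: "\<And>E. \<bar>edge_weight A s t E\<bar> \<le> D"
  shows "norm (z ^ n * g u - (\<Sum>k<n. of_real (walk_sum A s t k u) * z ^ (n - Suc k)))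
    \<le> (3 * D) ^ n * C"
proof (induction n arbitrary: u)
  case 0
  then show ?case using bound by simp
next
  case (Suc n)
  define r where "r n u = z ^ n * g u - (\<Sum>k<n. of_real (walk_sum A s t k u) * z ^ (n - Suc k))"
    for n u
  have "r (Suc n) u = (\<Sum>x\<in>neighbours u. of_real (edge_weight A s t {u, x}) * r n x)"
  proof -
    \<comment> \<open>The term k = 0 matches the inhomogeneous part of the equation for g; the
      shifted terms are T applied to the previous sum.\<close>
    have "(\<Sum>k<Suc n. of_real (walk_sum A s t k u) * z ^ (Suc n - Suc k))
        = of_real (walk_sum A s t 0 u) * z ^ n
          + (\<Sum>k<n. of_real (walk_sum A s t (Suc k) u) * z ^ (n - Suc k))"
      by (subst sum.lessThan_Suc_shift) simp
    also have "(\<Sum>k<n. of_real (walk_sum A s t (Suc k) u) * z ^ (n - Suc k))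
        = (\<Sum>x\<in>neighbours u. of_real (edge_weight A s t {u, x})
            * (\<Sum>k<n. of_real (walk_sum A s t k x) * z ^ (n - Suc k)))"
      unfolding walk_sum_Suc of_real_sum sum_distrib_left sum_distrib_right
      by (subst sum.swap) (simp add: mult_ac)
    finally have "r (Suc n) u = z ^ n * (z * g u - of_real (walk_sum A s t 0 u))
        - (\<Sum>x\<in>neighbours u. of_real (edge_weight A s t {u, x})
            * (\<Sum>k<n. of_real (walk_sum A s t k x) * z ^ (n - Suc k)))"
      unfolding r_def by (simp add: algebra_simps)
    also have "z * g u - of_real (walk_sum A s t 0 u)
        = (\<Sum>x\<in>neighbours u. of_real (edge_weight A s t {u, x}) * g x)"
      by (simp add: g walk_sum_0)
    finally show ?thesis
      unfolding r_def by (simp add: sum_distrib_left right_diff_distrib sum_subtractf mult_ac)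
  qed
  also have "norm \<dots> \<le> 3 * (D * ((3 * D) ^ n * C))"
  proof (rule norm_sum_neighbours_le)
    fix x
    have "0 \<le> D" using weight abs_ge_zero order_trans by blast
    then show "norm (of_real (edge_weight A s t {u, x}) * r n x) \<le> D * ((3 * D) ^ n * C)"
      unfolding norm_mult using weight Suc.IH by (intro mult_mono) (auto simp: r_def)
  qed
  finally show ?case unfolding r_def by (simp add: mult_ac)
qed

lemma edge_weight_child:
  assumes "vertex_label s t (c # v) = (p, q)"
  shows "edge_weight A s t {v, c # v} = A $ p $ q" "edge_weight A s t {c # v, v} = A $ p $ q"
proof -
  have "edge_weight A s t {v, c # v} = A $ p $ q"
    unfolding edge_weight_def edge_label_def lower_vertex_edge using assms by simp
  then show "edge_weight A s t {v, c # v} = A $ p $ q" "edge_weight A s t {c # v, v} = A $ p $ q"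
    by (simp_all add: insert_commute)
qed

lemma vertex_label_Cons_Cons:
  "vertex_label s t (c # v) = (p, q) \<Longrightarrow> vertex_label s t (d # c # v) = (d, p)"
  by simp

section \<open>The resolvent of the weighted tree\<close>

locale large_argument_2 = large_argument B M z for B :: "real ^ 2 ^ 2" and M z +
  fixes A :: "real ^ 2 ^ 2" and s t :: "2 \<times> 2"
  assumes A_def: "A = (\<chi> i j. sqrt (B $ i $ j))"
begin

text \<open>K-transforms add under boolean convolution, so this is the F-transform of the
  convolution at z.\<close>

definition root_denominator :: complex where
  "root_denominator = z - K_limit B (fst s) (snd s) z - K_limit B (fst t) (snd t) z"

text \<open>The expected resolvent entry between u and the root. On a tree it is a product along the
  path: an edge labelled (p, q) contributes its weight times the root entry for the subtree below
  it, whose root edges are labelled (1, p) and (2, p).\<close>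

primrec green :: "vertex \<Rightarrow> complex" where
  "green [] = 1 / root_denominator"
| "green (c # v) = (case vertex_label s t (c # v) of (p, q) \<Rightarrow>
     of_real (A $ p $ q) / (z - (\<Sum>r\<in>UNIV. K_limit B r p z)) * green v)"

lemma norm_root_denominator_ge: "norm z - 2 \<le> norm root_denominator"
  unfolding root_denominator_def
  using norm_triangle_ineq2[of "z - K_limit B (fst s) (snd s) z" "K_limit B (fst t) (snd t) z"]
    norm_triangle_ineq2[of z "K_limit B (fst s) (snd s) z"]
    norm_K_limit_le[of "fst s" "snd s"] norm_K_limit_le[of "fst t" "snd t"] by linarith

lemma norm_z_ge: "3 + 2 * M \<le> norm z"
  using z_large by simp

lemma root_denominator_nonzero: "root_denominator \<noteq> 0"
  using norm_root_denominator_ge norm_z_ge M_nonneg by auto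

lemma A_nonneg: "0 \<le> A $ p $ q"
  using B_nonneg by (simp add: A_def)

lemma A_mult_A: "A $ p $ q * A $ p $ q = B $ p $ q"
  using B_nonneg by (simp add: A_def)

lemma A_le: "A $ p $ q \<le> 1 + M"
proof -
  \<comment> \<open>The crude bound 1 + M on the square root stays below 1 + N M, the lower bound
    for the denominators.\<close>
  have "B $ p $ q \<le> (1 + M)\<^sup>2"
    using B_le[of p q] M_nonneg by (simp add: power2_eq_square algebra_simps)
      (smt (verit) mult_nonneg_nonneg)
  then show ?thesis
    using M_nonneg by (simp add: A_def real_le_lsqrt B_nonneg)
qed

text \<open>Crossing an edge down and back up squares its weight to an entry of \<open>B\<close>,
  and the fixed-point equation turns the resulting fraction into a K-transform.\<close>

lemma A_mult_green:
  assumes "vertex_label s t (c # v) = (p, q)"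
  shows "of_real (A $ p $ q) * green (c # v) = K_limit B p q z * green v"
proof -
  have "of_real (A $ p $ q) * green (c # v)
      = of_real (A $ p $ q * A $ p $ q) / (z - (\<Sum>r\<in>UNIV. K_limit B r p z)) * green v"
    using assms by simp
  also have "\<dots> = K_limit B p q z * green v"
    unfolding A_mult_A by (simp flip: K_limit_fixed_point)
  finally show ?thesis .
qed

text \<open>Every factor along the path has norm at most 1, so the bound at the root holds
  everywhere; its decay in z makes the final error vanish.\<close>

lemma norm_green_le: "norm (green u) \<le> 1 / (norm z - 2)"
proof (induction u)
  case Nil
  then show ?case
    using norm_root_denominator_ge norm_z_ge M_nonneg
    by (simp add: norm_divide frac_le)
next
  case (Cons c v)
  obtain p q where pq: "vertex_label s t (c # v) = (p, q)" by fastforce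
  let ?d = "z - (\<Sum>r\<in>UNIV. K_limit B r p z)"
  have "A $ p $ q \<le> norm ?d"
    using A_le[of p q] K_limit_denominator_ge[of p] M_le by simp
  then have "norm (of_real (A $ p $ q) / ?d) \<le> 1"
    using A_nonneg[of p q] by (simp add: norm_divide divide_le_eq_1)
  then have "norm (of_real (A $ p $ q) / ?d * green v) \<le> norm (green v)"
    unfolding norm_mult by (intro mult_left_le_one_le) auto
  with Cons show ?case using pq by simp
qed

text \<open>At the root this is the definition of \<open>root_denominator\<close> with denominators
  cleared. Elsewhere the parent contributes the numerator in the definition of \<open>green\<close>,
  and the two children contribute the K-transforms in its denominator.\<close>

lemma green_resolvent:
  "z * green u = (if u = [] then 1 else 0)
    + (\<Sum>x\<in>neighbours u. of_real (edge_weight A s t {u, x}) * green x)"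
proof (cases u)
  case Nil
  have "vertex_label s t [1] = (fst s, snd s)" "vertex_label s t [2] = (fst t, snd t)"
    by simp_all
  note child = edge_weight_child(1)[OF this(1)] edge_weight_child(1)[OF this(2)]
    A_mult_green[OF this(1)] A_mult_green[OF this(2)]
  have "z * green [] = 1 + K_limit B (fst s) (snd s) z * green []
      + K_limit B (fst t) (snd t) z * green []"
    using root_denominator_nonzero by (simp add: field_simps) (simp add: root_denominator_def)
  then show ?thesis
    unfolding Nil neighbours_Nil using child by (simp del: green.simps)
next
  case (Cons c v)
  obtain p q where pq: "vertex_label s t (c # v) = (p, q)" by fastforce
  note label = vertex_label_Cons_Cons[OF pq]
  \<comment> \<open>The parent differs from both children, so the sum over the neighbours has three
    separate terms.\<close>
  have len: "v \<noteq> d # c # v" for d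
    by (induction v arbitrary: c d) auto
  let ?d = "z - (\<Sum>r\<in>UNIV. K_limit B r p z)"
  have "?d * green (c # v) = of_real (A $ p $ q) * green v"
    using pq K_limit_denominator_nonzero[of p] by simp
  then have "z * green (c # v) = of_real (A $ p $ q) * green v
      + K_limit B 1 p z * green (c # v) + K_limit B 2 p z * green (c # v)"
    by (simp add: sum_2 algebra_simps del: green.simps)
  then show ?thesis
    unfolding Cons neighbours_Cons
    using len edge_weight_child(2)[OF pq, of A]
    by (simp add: edge_weight_child(1)[OF label, of A] A_mult_green[OF label] add_ac
        del: green.simps vertex_label.simps)
qed

lemma norm_green_remainder_le:
  "norm (z ^ n * green [] - (\<Sum>k<n. of_real (walk_sum A s t k []) * z ^ (n - Suc k)))
    \<le> (3 * (1 + M)) ^ n * (1 / (norm z - 2))"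
proof (rule resolvent_expansion[OF _ green_resolvent norm_green_le])
  show "z \<noteq> 0" using norm_z_ge M_nonneg by auto
  show "\<bar>edge_weight A s t E\<bar> \<le> 1 + M" for E
    using A_nonneg A_le by (simp add: edge_weight_def split: prod.split)
qed

end

section \<open>From the resolvent expansion to the moments of the convolution\<close>

theorem has_moment_walk_sum:
  fixes A B :: "real ^ 2 ^ 2"
  assumes B: "\<And>i j. 0 \<le> B $ i $ j"
    and A: "A = (\<chi> i j. sqrt (B $ i $ j))"
    and K: "has_K_transform \<rho> (\<lambda>z. K_limit B (fst s) (snd s) z + K_limit B (fst t) (snd t) z)"
  shows "has_moment \<rho> n (\<Sum>w\<in>root_walks n. walk_weight A s t w)"
proof -
  define M where "M = (\<Sum>i\<in>UNIV. \<Sum>j\<in>UNIV. B $ i $ j)"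
  have B_le: "B $ i $ j \<le> M" for i j
  proof -
    have "B $ i $ j \<le> (\<Sum>j\<in>UNIV. B $ i $ j)"
      using B by (intro member_le_sum) auto
    also have "\<dots> \<le> M"
      unfolding M_def using B
      by (intro member_le_sum[of i UNIV "\<lambda>i. \<Sum>j\<in>UNIV. B $ i $ j"] sum_nonneg) auto
    finally show ?thesis .
  qed
  let ?S = "\<lambda>k. walk_sum A s t k []"
  have "((\<lambda>y. Cauchy_remainder \<rho> ?S n (\<i> * of_real y)) \<longlongrightarrow> of_real (?S n)) at_top" for n
  proof -
    \<comment> \<open>The threshold 3 + 2 M is the locale bound for two indices. Subtracting the
      coefficient of index n turns the remainder into the error of the resolvent expansion of order
      n + 1, whence the exponent \<open>Suc n\<close>.\<close>
    have "norm (Cauchy_remainder \<rho> ?S n (\<i> * of_real y) - of_real (?S n))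
        \<le> (3 * (1 + M)) ^ Suc n * (1 / (y - 2))" if y: "3 + 2 * M \<le> y" for y
    proof -
      define z where "z = \<i> * complex_of_real y"
      have "0 \<le> M" using B B_le order_trans by blast
      with y have "norm z = y" "Im z > 0" by (simp_all add: z_def norm_mult)
      interpret large_argument_2 B M z A s t
        by unfold_locales (use B B_le y A \<open>norm z = y\<close> in auto)
      have "K_transform \<rho> z = K_limit B (fst s) (snd s) z + K_limit B (fst t) (snd t) z"
        using K \<open>Im z > 0\<close> unfolding has_K_transform_def by blast
      then have "1 / Cauchy_transform \<rho> z = root_denominator"
        unfolding K_transform_def F_transform_def root_denominator_def by (simp add: algebra_simps)
      \<comment> \<open>Since 1 / 0 = 0, taking reciprocals twice is the identity even at 0, so no
        case distinction on the Cauchy transform arises.\<close>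
      then have "Cauchy_transform \<rho> z = green []"
        by (metis green.simps(1) div_by_1 divide_divide_eq_right mult_1)
      moreover have "(\<Sum>k<n. of_real (?S k) * z ^ (n - k)) + of_real (?S n)
          = (\<Sum>k<Suc n. of_real (?S k) * z ^ (Suc n - Suc k))"
        by simp
      ultimately have "Cauchy_remainder \<rho> ?S n z - of_real (?S n)
          = z ^ Suc n * green [] - (\<Sum>k<Suc n. of_real (?S k) * z ^ (Suc n - Suc k))"
        unfolding Cauchy_remainder_def by (simp add: diff_diff_eq)
      then show ?thesis
        using norm_green_remainder_le[of "Suc n"] \<open>norm z = y\<close> unfolding z_def
        by (simp only:)
    qed
    then have "eventually (\<lambda>y. norm (Cauchy_remainder \<rho> ?S n (\<i> * of_real y) - of_real (?S n))
        \<le> (3 * (1 + M)) ^ Suc n * (1 / (y - 2))) at_top"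
      by (rule eventually_mono[OF eventually_ge_at_top])
    moreover have "((\<lambda>y::real. (3 * (1 + M)) ^ Suc n * (1 / (y - 2))) \<longlongrightarrow> 0) at_top"
    proof -
      have "((\<lambda>y::real. 1 / (y - 2)) \<longlongrightarrow> 0) at_top"
        by real_asymp
      then show ?thesis by (rule tendsto_mult_right_zero)
    qed
    ultimately have "((\<lambda>y. Cauchy_remainder \<rho> ?S n (\<i> * of_real y) - of_real (?S n)) \<longlongrightarrow> 0) at_top"
      by (rule Lim_null_comparison)
    then show ?thesis by (rule LIM_zero_cancel)
  qed
  moreover have "real_distribution \<rho>"
    using K unfolding has_K_transform_def by blast
  ultimately have "has_moment \<rho> n (?S n)"
    using has_moment_of_Cauchy_asymptotics[of \<rho> ?S] by blast
  then show ?thesis by (simp add: walk_sum_def walks_to_root_def root_walks_def)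
qed

theorem theorem9p1:
  fixes A B :: "real ^ 2 ^ 2"
    and \<mu> :: "2 \<Rightarrow> 2 \<Rightarrow> real measure"
    and \<mu>\<^sub>0 \<mu>\<^sub>1 \<mu>\<^sub>2 :: "real measure"
    and n :: nat
  assumes "\<And>i j. B $ i $ j \<ge> 0"
    and "A = (\<chi> i j. sqrt (B $ i $ j))"
    and "\<And>i j. has_K_transform (\<mu> i j) (K_limit B i j)"
    and "is_boolean_convolution (\<mu> 1 1) (\<mu> 2 2) \<mu>\<^sub>0"
    and "is_boolean_convolution (\<mu> 1 1) (\<mu> 2 1) \<mu>\<^sub>1"
    and "is_boolean_convolution (\<mu> 1 2) (\<mu> 2 2) \<mu>\<^sub>2"
  shows "has_moment \<mu>\<^sub>0 n (\<Sum>w\<in>root_walks n. walk_weight A (1, 1) (2, 2) w) \<and>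
         has_moment \<mu>\<^sub>1 n (\<Sum>w\<in>root_walks n. walk_weight A (1, 1) (2, 1) w) \<and>
         has_moment \<mu>\<^sub>2 n (\<Sum>w\<in>root_walks n. walk_weight A (1, 2) (2, 2) w)"
proof -
  \<comment> \<open>The K-transform condition concerns the upper half-plane only, where both
    summands may be replaced by the continued-fraction limits. Pairs s and t of labels treat all
    three convolutions at once.\<close>
  have "has_K_transform \<rho> (\<lambda>z. K_limit B (fst s) (snd s) z + K_limit B (fst t) (snd t) z)"
    if "is_boolean_convolution (\<mu> (fst s) (snd s)) (\<mu> (fst t) (snd t)) \<rho>" for \<rho> s t
    using that assms(3) unfolding is_boolean_convolution_def has_K_transform_def by simp
  then have "has_moment \<rho> n (\<Sum>w\<in>root_walks n. walk_weight A s t w)"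
    if "is_boolean_convolution (\<mu> (fst s) (snd s)) (\<mu> (fst t) (snd t)) \<rho>" for \<rho> s t
    using that assms(1,2) by (intro has_moment_walk_sum)
  then show ?thesis
    using assms(4-6) by simp
qed

end
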